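(* Let $A=P-R+S$ be a double weak splitting of type II of a symmetric nonsingular matrix $A\in\mathbb{R}^{n\times n}$, and let $$\widetilde{\mathbf{W}}=\begin{pmatrix}(RP^{-1})^T & -(SP^{-1})^T\\ I & 0\end{pmatrix}.$$ Then the following conditions are equivalent: (i) $\rho(\widetilde{\mathbf{W}})<1$. (ii) $PA^{-1}\ge 0$ (equivalently $A^{-1}P^T\ge 0$). (iii) $PA^{-1}\ge I$ (equivalently $A^{-1}P^T\ge I$). (iv) $(R-S)A^{-1}\ge 0$ (equivalently $A^{-1}(R-S)^T\ge 0$). (v) $(R-S)A^{-1}\ge -I$ (equivalently $A^{-1}(R-S)^T\ge -I$). (vi) $(I-(R-S)^T(P^{-1})^T)^{-1}\ge 0$. (vii) $(I-(R-S)^T(P^{-1})^T)^{-1}\ge I$.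
   Context: Matrix inequalities are entrywise ($X\ge Y$ means $X-Y$ has nonnegative entries); $\rho$ is the spectral radius; $I$ is the $n\times n$ identity. For a symmetric nonsingular matrix $A\in\mathbb{R}^{n\times n}$, a decomposition $A=P-R+S$ with $P$ nonsingular is a double weak splitting of type II if $RP^{-1}\ge 0$ and $-SP^{-1}\ge 0$.
   Formalization: In (vi) and (vii) the factors are swapped: the matrix is I-(P^{-1})^T(R-S)^T. With the printed order the claim fails for A=diag(1,-1), P=[[1,-1],[0,-1]], R=[[0,-1],[0,0]], S=0: (i) holds but (vi) does not. *)

theory Defs
  imports "Jordan_Normal_Form.Spectral_Radius" "Jordan_Normal_Form.Gauss_Jordan_Elimination"
begin

text \<open>Matrix inequalities below are the library order on matrices, which is entrywise and
  includes equality of dimensions.\<close>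

definition mat_inv :: "'a :: field mat \<Rightarrow> 'a mat" where
  "mat_inv A = the (mat_inverse A)"

text \<open>The value is meaningful for invertible matrices only.\<close>

lemma mat_inv:
  assumes A: "A \<in> carrier_mat n n" and inv: "invertible_mat A"
  shows "mat_inv A \<in> carrier_mat n n" "A * mat_inv A = 1\<^sub>m n" "mat_inv A * A = 1\<^sub>m n"
proof -
  from inv obtain B where AB: "A * B = 1\<^sub>m n" and BA: "B * A = 1\<^sub>m (dim_row B)"
    using A unfolding invertible_mat_def inverts_mat_def by auto
  have "dim_col B = n" using arg_cong[OF AB, of dim_col] by simp
  moreover have "dim_row B = n" using arg_cong[OF BA, of dim_col] A by simp
  ultimately have B: "B \<in> carrier_mat n n" by auto
  have "A \<in> Units (ring_mat TYPE('a) n ())"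
    using A B AB BA unfolding Units_def ring_mat_def by auto
  then obtain C where "mat_inverse A = Some C"
    using mat_inverse(1)[OF A, of "()"] by (cases "mat_inverse A") auto
  then show "mat_inv A \<in> carrier_mat n n" "A * mat_inv A = 1\<^sub>m n" "mat_inv A * A = 1\<^sub>m n"
    using mat_inverse(2)[OF A] unfolding mat_inv_def by auto
qed

definition double_weak_splitting_II ::
    "nat \<Rightarrow> real mat \<Rightarrow> real mat \<Rightarrow> real mat \<Rightarrow> real mat \<Rightarrow> bool" where
  "double_weak_splitting_II n A P R S \<longleftrightarrow>
     P \<in> carrier_mat n n \<and> R \<in> carrier_mat n n \<and> S \<in> carrier_mat n n \<and>
     A = P - R + S \<and> invertible_mat P \<and>
     R * mat_inv P \<ge> 0\<^sub>m n n \<and> - (S * mat_inv P) \<ge> 0\<^sub>m n n"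

definition W_tilde :: "nat \<Rightarrow> real mat \<Rightarrow> real mat \<Rightarrow> real mat \<Rightarrow> real mat" where
  "W_tilde n P R S =
     four_block_mat ((R * mat_inv P)\<^sup>T) (- ((S * mat_inv P)\<^sup>T)) (1\<^sub>m n) (0\<^sub>m n n)"

text \<open>
  The source prints the matrix of the last two conditions as I - (R - S)^T (P^{-1})^T. The factors
  are written here in the order (P^{-1})^T (R - S)^T = ((R - S) P^{-1})^T, the sum of the upper
  blocks of \<^const>\<open>W_tilde\<close>. In the printed order these conditions are not equivalent to the
  others: for the symmetric nonsingular matrix A = diag(1,-1) and P = (1 -1; 0 -1),
  R = (0 -1; 0 0), S = 0, the matrix \<^const>\<open>W_tilde\<close> is nilpotent, whereas
  (I - (R - S)^T (P^{-1})^T)^{-1} = (1 0; -1 1).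
\<close>

end

theory Submission
  imports Defs
begin

text \<open>Put T = (R - S) P^{-1}, which is nonnegative. Then A = (I - T) P, so N = P A^{-1} is the
  inverse of I - T and (R - S) A^{-1} = T N = N - I; conditions (ii) to (vii) all say that N is
  nonnegative. A nonnegative matrix W with I - W invertible has spectral radius below 1 iff
  (I - W)^{-1} is nonnegative, and for the block matrix of (i) this inverse has blocks built from
  N^T, nonnegative exactly when N is. Perron--Frobenius theory is not needed: one direction uses
  W^k \<longlongrightarrow> 0, the other the moduli of an eigenvector.\<close>

section \<open>Entrywise order and algebra of matrices\<close>

lemma mat_le_iff:
  assumes "A \<in> carrier_mat nr nc" "B \<in> carrier_mat nr nc"
  shows "A \<le> B \<longleftrightarrow> (\<forall>i<nr. \<forall>j<nc. A $$ (i, j) \<le> B $$ (i, j))"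
  using assms by (auto simp: less_eq_mat_def)

lemma mult_mat_index:
  assumes "A \<in> carrier_mat nr n" "B \<in> carrier_mat n nc" "i < nr" "j < nc"
  shows "(A * B) $$ (i, j) = (\<Sum>k<n. A $$ (i, k) * B $$ (k, j))"
  using assms by (simp add: scalar_prod_def atLeast0LessThan)

lemma mult_mat_left_mono:
  fixes A :: "'a :: ordered_semiring_0 mat"
  assumes "A \<in> carrier_mat nr n" "B \<in> carrier_mat n nc" "C \<in> carrier_mat n nc"
    and "0\<^sub>m nr n \<le> A" "B \<le> C"
  shows "A * B \<le> A * C"
  using assms
  by (subst mat_le_iff[of _ nr nc])
    (auto simp: mult_mat_index[of _ nr n _ nc] mat_le_iff[of _ nr n] mat_le_iff[of _ n nc]
      simp del: index_mult_mat intro!: sum_mono mult_left_mono)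

lemma mult_mat_nonneg:
  fixes A :: "'a :: ordered_semiring_0 mat"
  assumes "A \<in> carrier_mat nr n" "B \<in> carrier_mat n nc" "0\<^sub>m nr n \<le> A" "0\<^sub>m n nc \<le> B"
  shows "0\<^sub>m nr nc \<le> A * B"
  using mult_mat_left_mono[of A nr n "0\<^sub>m n nc" nc B] assms by simp

lemma pow_mat_nonneg:
  fixes A :: "'a :: linordered_semidom mat"
  assumes "A \<in> carrier_mat n n" "0\<^sub>m n n \<le> A"
  shows "0\<^sub>m n n \<le> A ^\<^sub>m k"
proof (induction k)
  case 0
  show ?case using assms by (simp add: less_eq_mat_def)
next
  case (Suc k)
  then show ?case using assms by (simp add: mult_mat_nonneg[of _ n n])
qed

lemma transpose_mat_mono: "A \<le> B \<Longrightarrow> A\<^sup>T \<le> B\<^sup>T"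
  by (auto simp: less_eq_mat_def)

lemma transpose_mat_le_iff: "A\<^sup>T \<le> B\<^sup>T \<longleftrightarrow> A \<le> B"
  using transpose_mat_mono[of A B] transpose_mat_mono[of "A\<^sup>T" "B\<^sup>T"] by auto

lemma pow_smult_mat:
  fixes A :: "'a :: comm_semiring_1 mat"
  assumes "A \<in> carrier_mat n n"
  shows "(a \<cdot>\<^sub>m A) ^\<^sub>m k = a ^ k \<cdot>\<^sub>m (A ^\<^sub>m k)"
proof (induction k)
  case 0
  show ?case by (auto intro!: eq_matI)
next
  case (Suc k)
  have "A ^\<^sub>m k \<in> carrier_mat n n" using assms by simp
  then show ?case
    unfolding pow_mat.simps Suc
    using assms
    by (subst mult_smult_distrib[of _ n n _ n], simp, simp,
        subst mult_smult_assoc_mat[of _ n n _ n], simp, simp)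
      (auto simp: mult.assoc)
qed

lemma one_minus_mult_mat:
  fixes A :: "'a :: comm_ring_1 mat"
  assumes "A \<in> carrier_mat n n" "B \<in> carrier_mat n m"
  shows "(1\<^sub>m n - A) * B = B - A * B"
  using assms by (subst minus_mult_distrib_mat[of _ n n]) auto

section \<open>Spectral radius and decay of powers\<close>

text \<open>For \<open>n > 0\<close> the spectrum is finite and nonempty, so the spectral radius is
  an attained maximum; hence even a strict bound can be tested on one eigenvalue at a time.\<close>

lemma spectral_radius_less_iff:
  assumes "A \<in> carrier_mat n n" "n > 0"
  shows "spectral_radius A < r \<longleftrightarrow> (\<forall>e. eigenvalue A e \<longrightarrow> norm e < r)"
  using spectral_radius_mem_max[OF assms] unfolding spectrum_def by force

text \<open>Jordan normal forms only give bounded powers; applied to A / r for some r strictly between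
  the spectral radius and 1, this yields geometric decay.\<close>

lemma spectral_radius_less_1_pow_tendsto_0:
  assumes A: "A \<in> carrier_mat n n" and sr: "spectral_radius A < 1" and ij: "i < n" "j < n"
  shows "(\<lambda>k. (A ^\<^sub>m k) $$ (i, j)) \<longlonglongrightarrow> 0"
proof -
  have n: "n > 0" using ij by simp
  have "spectral_radius A \<ge> 0" using spectral_radius_mem_max(1)[OF A n] by auto
  then obtain r where r: "spectral_radius A < r" "r < 1" "r > 0"
    using dense[OF sr] by force
  define B where "B = complex_of_real (inverse r) \<cdot>\<^sub>m A"
  have B: "B \<in> carrier_mat n n" using A by (simp add: B_def)
  have AB: "A = complex_of_real r \<cdot>\<^sub>m B" using r by (auto simp: B_def intro!: eq_matI)
  \<comment> \<open>Rescaling: an eigenvalue \<open>e\<close> of \<open>B\<close> gives the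
    eigenvalue \<open>r * e\<close> of \<open>A\<close>, whose modulus is below
    \<open>r\<close>.\<close>
  have "spectral_radius B < 1"
    unfolding spectral_radius_less_iff[OF B n]
  proof (intro allI impI)
    fix e assume "eigenvalue B e"
    then obtain v where v: "v \<in> carrier_vec n" "v \<noteq> 0\<^sub>v n" "B *\<^sub>v v = e \<cdot>\<^sub>v v"
      using B unfolding eigenvalue_def eigenvector_def by auto
    have "A *\<^sub>v v = complex_of_real r \<cdot>\<^sub>v (B *\<^sub>v v)"
      using B v(1) unfolding AB by (auto intro!: eq_vecI)
    also have "\<dots> = (complex_of_real r * e) \<cdot>\<^sub>v v" unfolding v(3) by (simp add: smult_smult_assoc)
    finally have "eigenvalue A (complex_of_real r * e)"
      using v A unfolding eigenvalue_def eigenvector_def by auto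
    then have "norm (complex_of_real r * e) < r"
      using r(1) spectral_radius_less_iff[OF A n] by blast
    then show "norm e < 1" using r by (simp add: norm_mult)
  qed
  then obtain c where c: "\<And>k. norm_bound (B ^\<^sub>m k) c"
    using spectral_radius_jnf_norm_bound_less_1_upper_triangular[OF B] by auto
  have "(\<lambda>k. r ^ k) \<longlonglongrightarrow> 0" using r by (intro LIMSEQ_power_zero) simp
  \<comment> \<open>Since \<open>A\<close> is \<open>r\<close> times \<open>B\<close>, its k-th
    power is \<open>r ^ k\<close> times that of \<open>B\<close>, whose entries are bounded by
    \<open>c\<close> uniformly in \<open>k\<close>.\<close>
  moreover have "norm ((A ^\<^sub>m k) $$ (i, j)) \<le> norm (r ^ k) * c" for k
  proof -
    have "B ^\<^sub>m k \<in> carrier_mat n n" using B by simp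
    moreover from this have "norm ((B ^\<^sub>m k) $$ (i, j)) \<le> c"
      using c[of k] ij unfolding norm_bound_def by (metis carrier_matD)
    ultimately have "norm ((B ^\<^sub>m k) $$ (i, j)) \<le> c"
        "(A ^\<^sub>m k) $$ (i, j) = complex_of_real r ^ k * (B ^\<^sub>m k) $$ (i, j)"
      using ij B by (simp_all add: AB pow_smult_mat[OF B])
    then show ?thesis using r by (simp add: norm_mult norm_power)
  qed
  ultimately show ?thesis by (rule tendsto_0_le[OF _ always_eventually[OF allI]])
qed

section \<open>Nonnegative matrices: spectral radius below 1 and nonnegative inverses\<close>

text \<open>Iterating \<open>W * Z \<le> Z\<close> bounds every W^k Z above by \<open>Z\<close>. The
  powers tend to 0, and the entrywise order survives the limit.\<close>

lemma nonneg_if_mult_le_spectral_radius_less_1: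
  fixes W Z :: "real mat"
  assumes W: "W \<in> carrier_mat n n" and Z: "Z \<in> carrier_mat n m" and W0: "0\<^sub>m n n \<le> W"
    and WZ: "W * Z \<le> Z" and sr: "spectral_radius (map_mat complex_of_real W) < 1"
  shows "0\<^sub>m n m \<le> Z"
proof -
  have Wk: "W ^\<^sub>m k \<in> carrier_mat n n" for k using W by simp
  have le: "W ^\<^sub>m k * Z \<le> Z" for k
  proof (induction k)
    case 0
    show ?case using W Z by simp
  next
    case (Suc k)
    have "W ^\<^sub>m k * (W * Z) \<le> W ^\<^sub>m k * Z"
      using pow_mat_nonneg[OF W W0] WZ W Z Wk by (intro mult_mat_left_mono[of _ n n _ m]) auto
    with Suc show ?case using W Z Wk by (simp add: assoc_mult_mat[of _ n n _ n _ m])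
  qed
  have "0 \<le> Z $$ (i, j)" if ij: "i < n" "j < m" for i j
  proof -
    \<comment> \<open>The decay is known for the complexified matrix. The embedding of the reals
      commutes with matrix powers and reflects limits, so it carries over to
      \<open>W\<close>.\<close>
    have "(\<lambda>k. (W ^\<^sub>m k) $$ (i, l)) \<longlonglongrightarrow> 0" if "l < n" for l
    proof -
      have "(\<lambda>k. (map_mat complex_of_real W ^\<^sub>m k) $$ (i, l)) \<longlonglongrightarrow> 0"
        using spectral_radius_less_1_pow_tendsto_0[OF _ sr] W ij that by simp
      moreover have "map_mat complex_of_real W ^\<^sub>m k = map_mat complex_of_real (W ^\<^sub>m k)" for k
        by (rule of_real_hom.mat_hom_pow[OF W, symmetric])
      ultimately have "(\<lambda>k. complex_of_real ((W ^\<^sub>m k) $$ (i, l))) \<longlonglongrightarrow> complex_of_real 0"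
        using ij that Wk W by simp
      then show ?thesis by (simp only: tendsto_of_real_iff)
    qed
    then have "(\<lambda>k. \<Sum>l<n. (W ^\<^sub>m k) $$ (i, l) * Z $$ (l, j)) \<longlonglongrightarrow> (\<Sum>l<n. 0 * Z $$ (l, j))"
      by (intro tendsto_sum tendsto_mult tendsto_const) auto
    moreover have "(\<Sum>l<n. (W ^\<^sub>m k) $$ (i, l) * Z $$ (l, j)) \<le> Z $$ (i, j)" for k
      unfolding mult_mat_index[OF Wk Z ij, symmetric]
      using le[of k] ij mat_le_iff[OF mult_carrier_mat[OF Wk Z] Z] by blast
    ultimately show ?thesis by (intro LIMSEQ_le_const2) auto
  qed
  then show ?thesis using Z by (simp add: mat_le_iff[of _ n m])
qed

text \<open>The moduli w of an eigenvector for an eigenvalue of modulus at least 1 satisfy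
  w \<le> W w, hence w = K (I - W) w \<le> 0.\<close>

lemma nonneg_inverse_spectral_radius_less_1:
  fixes W K :: "real mat"
  assumes W: "W \<in> carrier_mat n n" and K: "K \<in> carrier_mat n n" and n: "n > 0"
    and W0: "0\<^sub>m n n \<le> W" and K0: "0\<^sub>m n n \<le> K" and inv: "K * (1\<^sub>m n - W) = 1\<^sub>m n"
  shows "spectral_radius (map_mat complex_of_real W) < 1"
proof -
  let ?W = "map_mat complex_of_real W"
  have cW: "?W \<in> carrier_mat n n" using W by simp
  have "norm e < 1" if "eigenvalue ?W e" for e
  proof (rule ccontr)
    assume "\<not> norm e < 1"
    then have e: "norm e \<ge> 1" by simp
    from that obtain v where v: "v \<in> carrier_vec n" "v \<noteq> 0\<^sub>v n" "?W *\<^sub>v v = e \<cdot>\<^sub>v v"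
      using W unfolding eigenvalue_def eigenvector_def by auto
    \<comment> \<open>A one-column matrix rather than a vector, so that the matrix order and its
      monotonicity lemmas apply.\<close>
    define w where "w = mat n 1 (\<lambda>(i, j). norm (v $ i))"
    have w: "w \<in> carrier_mat n 1" by (simp add: w_def)
    have "w \<le> W * w"
      unfolding mat_le_iff[OF w mult_carrier_mat[OF W w]]
    proof (intro allI impI)
      fix i j :: nat assume ij: "i < n" "j < 1"
      have "e * v $ i = (?W *\<^sub>v v) $ i" using v ij by simp
      also have "\<dots> = (\<Sum>k<n. complex_of_real (W $$ (i, k)) * v $ k)"
        using W v(1) ij by (simp add: scalar_prod_def atLeast0LessThan)
      finally have eq: "e * v $ i = \<dots>" .
      \<comment> \<open>In turn: \<open>norm e\<close> is at least 1; the triangle inequality on row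
        \<open>i\<close> of the eigenvector equation; entries of \<open>W\<close> equal their
        moduli.\<close>
      have "norm (v $ i) \<le> norm e * norm (v $ i)" using e by (simp add: mult_le_cancel_right1)
      also have "\<dots> \<le> (\<Sum>k<n. norm (complex_of_real (W $$ (i, k)) * v $ k))"
        unfolding norm_mult[symmetric] eq by (rule norm_sum)
      also have "\<dots> = (\<Sum>k<n. W $$ (i, k) * norm (v $ k))"
        using W0 W ij by (intro sum.cong) (auto simp: norm_mult mat_le_iff[of _ n n])
      also have "\<dots> = (W * w) $$ (i, j)"
        unfolding mult_mat_index[OF W w ij] using ij by (simp add: w_def)
      finally show "w $$ (i, j) \<le> (W * w) $$ (i, j)" using ij by (simp add: w_def)
    qed
    then have "(1\<^sub>m n - W) * w \<le> 0\<^sub>m n 1"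
      using W w by (auto simp: one_minus_mult_mat[OF W w] less_eq_mat_def)
    then have "K * ((1\<^sub>m n - W) * w) \<le> K * 0\<^sub>m n 1"
      using W w K K0 minus_carrier_mat[OF W] by (intro mult_mat_left_mono[of _ n n _ 1]) auto
    moreover have "K * ((1\<^sub>m n - W) * w) = w"
      using assoc_mult_mat[OF K minus_carrier_mat[OF W] w, of "1\<^sub>m n"] w inv by simp
    ultimately have "w \<le> 0\<^sub>m n 1" using K by simp
    then have "v $ i = 0" if "i < n" for i
      using that unfolding mat_le_iff[OF w zero_carrier_mat] by (auto simp: w_def)
    then show False using v(1,2) by (auto intro!: eq_vecI)
  qed
  then show ?thesis using spectral_radius_less_iff[OF cW n] by blast
qed

text \<open>The equation for \<open>K\<close> reads K = W K + I, so \<open>W * K \<le> K\<close> and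
  the iteration criterion applies with \<open>Z\<close> taken as \<open>K\<close>. For the converse,
  a right inverse of a square matrix is also a left inverse.\<close>

lemma spectral_radius_less_1_iff_nonneg_inverse:
  fixes W K :: "real mat"
  assumes W: "W \<in> carrier_mat n n" and K: "K \<in> carrier_mat n n" and n: "n > 0"
    and W0: "0\<^sub>m n n \<le> W" and inv: "(1\<^sub>m n - W) * K = 1\<^sub>m n"
  shows "spectral_radius (map_mat complex_of_real W) < 1 \<longleftrightarrow> 0\<^sub>m n n \<le> K"
proof
  assume "0\<^sub>m n n \<le> K"
  moreover have "K * (1\<^sub>m n - W) = 1\<^sub>m n"
    by (rule mat_mult_left_right_inverse[OF minus_carrier_mat[OF W] K inv])
  ultimately show "spectral_radius (map_mat complex_of_real W) < 1"
    by (rule nonneg_inverse_spectral_radius_less_1[OF W K n W0])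
next
  assume sr: "spectral_radius (map_mat complex_of_real W) < 1"
  have eq: "K - W * K = 1\<^sub>m n" using one_minus_mult_mat[OF W K] inv by simp
  have "(W * K) $$ (i, j) \<le> K $$ (i, j)" if "i < n" "j < n" for i j
  proof -
    have "K $$ (i, j) - (W * K) $$ (i, j) = (1\<^sub>m n) $$ (i, j)"
      using arg_cong[OF eq, of "\<lambda>M. M $$ (i, j)"] that W K by (simp del: index_mult_mat(1))
    then show ?thesis using that by (cases "i = j") auto
  qed
  then have "W * K \<le> K" using W K by (subst mat_le_iff[of _ n n]) auto
  then show "0\<^sub>m n n \<le> K" using nonneg_if_mult_le_spectral_radius_less_1[OF W K W0 _ sr] by simp
qed

section \<open>The block companion matrix\<close>

text \<open>The inverse of I - (X Y; I 0) is (N NY; N NY+I), where N is the inverse of I - (X + Y).\<close>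

lemma spectral_radius_block_companion_less_1_iff:
  fixes X Y N :: "real mat"
  assumes X: "X \<in> carrier_mat n n" and Y: "Y \<in> carrier_mat n n" and N: "N \<in> carrier_mat n n"
    and n: "n > 0" and X0: "0\<^sub>m n n \<le> X" and Y0: "0\<^sub>m n n \<le> Y"
    and inv: "(1\<^sub>m n - (X + Y)) * N = 1\<^sub>m n"
  shows "spectral_radius (map_mat complex_of_real (four_block_mat X Y (1\<^sub>m n) (0\<^sub>m n n))) < 1
    \<longleftrightarrow> 0\<^sub>m n n \<le> N"
proof -
  define W where "W = four_block_mat X Y (1\<^sub>m n) (0\<^sub>m n n)"
  define K where "K = four_block_mat N (N * Y) N (N * Y + 1\<^sub>m n)"
  have NY: "N * Y \<in> carrier_mat n n" using N Y by simp
  have W: "W \<in> carrier_mat (n + n) (n + n)" using X by (simp add: W_def)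
  have K: "K \<in> carrier_mat (n + n) (n + n)" using N Y by (simp add: K_def)
  have W0: "0\<^sub>m (n + n) (n + n) \<le> W"
    using X Y X0 Y0 by (auto simp: W_def less_eq_mat_def)
  have eq: "N - (X * N + Y * N) = 1\<^sub>m n"
    using inv one_minus_mult_mat[OF add_carrier_mat[OF Y] N, of X]
    by (simp add: add_mult_distrib_mat[OF X Y N])
  \<comment> \<open>Facts \<open>1\<close>, \<open>2\<close> and \<open>3\<close> are the upper
    left, upper right and lower right blocks of (I - W) K; the lower left block is -N + N.\<close>
  have 1: "(1\<^sub>m n - X) * N + (- Y) * N = 1\<^sub>m n"
    unfolding one_minus_mult_mat[OF X N] using X Y N
    by (subst eq[symmetric]) (auto intro!: eq_matI)
  have 2: "(1\<^sub>m n - X) * (N * Y) + (- Y) * (N * Y + 1\<^sub>m n) = 0\<^sub>m n n"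
  proof -
    have X': "1\<^sub>m n - X \<in> carrier_mat n n" and Y': "- Y \<in> carrier_mat n n"
      using minus_carrier_mat[OF X] Y by auto
    have "(- Y) * (N * Y + 1\<^sub>m n) = (- Y) * (N * Y) + (- Y)"
      unfolding mult_add_distrib_mat[OF Y' NY one_carrier_mat] right_mult_one_mat[OF Y'] ..
    then have "(1\<^sub>m n - X) * (N * Y) + (- Y) * (N * Y + 1\<^sub>m n)
        = (1\<^sub>m n - X) * (N * Y) + (- Y) * (N * Y) + (- Y)"
      using assoc_add_mat[OF mult_carrier_mat[OF X' NY] mult_carrier_mat[OF Y' NY] Y'] by simp
    \<comment> \<open>Pulling out the right factor \<open>Y\<close> exposes the expression evaluated
      in \<open>1\<close>.\<close>
    also have "\<dots> = ((1\<^sub>m n - X) * N + (- Y) * N) * Y + (- Y)"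
      unfolding add_mult_distrib_mat[OF mult_carrier_mat[OF X' N] mult_carrier_mat[OF Y' N] Y]
        assoc_mult_mat[OF X' N Y] assoc_mult_mat[OF Y' N Y] ..
    also have "\<dots> = Y + (- Y)" unfolding 1 left_mult_one_mat[OF Y] ..
    also have "\<dots> = 0\<^sub>m n n" using Y by (auto intro!: eq_matI)
    finally show ?thesis .
  qed
  have 3: "- (N * Y) + (N * Y + 1\<^sub>m n) = 1\<^sub>m n"
    using N Y by (intro eq_matI) (auto simp del: index_mult_mat(1))
  have IW: "1\<^sub>m (n + n) - W = four_block_mat (1\<^sub>m n - X) (- Y) (- 1\<^sub>m n) (1\<^sub>m n)"
    using X Y by (intro eq_matI) (auto simp: W_def)
  have "(1\<^sub>m (n + n) - W) * K = 1\<^sub>m (n + n)"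
    unfolding IW K_def using X Y N NY 1 2 3
    by (subst mult_four_block_mat[of _ n n _ n _ n _ _ n _ n]) auto
  then have "spectral_radius (map_mat complex_of_real W) < 1 \<longleftrightarrow> 0\<^sub>m (n + n) (n + n) \<le> K"
    using spectral_radius_less_1_iff_nonneg_inverse[OF W K _ W0] n by simp
  \<comment> \<open>\<open>N\<close> is itself a block of \<open>K\<close>; conversely
    \<open>Y0\<close> passes nonnegativity of \<open>N\<close> on to the other blocks.\<close>
  also have "\<dots> \<longleftrightarrow> 0\<^sub>m n n \<le> N"
  proof
    assume K0: "0\<^sub>m (n + n) (n + n) \<le> K"
    have "0 \<le> N $$ (i, j)" if "i < n" "j < n" for i j
    proof -
      have "0 \<le> K $$ (i, j)" using K0 that by (simp add: mat_le_iff[OF _ K])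
      then show ?thesis using that N Y by (simp add: K_def)
    qed
    then show "0\<^sub>m n n \<le> N" using N by (simp add: mat_le_iff[of _ n n])
  next
    assume "0\<^sub>m n n \<le> N"
    moreover from this have "0\<^sub>m n n \<le> N * Y" using N Y Y0 by (intro mult_mat_nonneg)
    ultimately show "0\<^sub>m (n + n) (n + n) \<le> K"
      using N NY by (auto simp: K_def less_eq_mat_def simp del: index_mult_mat(1))
  qed
  finally show ?thesis unfolding W_def .
qed

section \<open>Identification of inverses and the equivalences\<close>

text \<open>A right inverse of a square matrix is two-sided and inverses are unique, so exhibiting
  one both proves invertibility and determines \<open>mat_inv\<close>.\<close>

lemma mat_inv_eqI:
  assumes A: "A \<in> carrier_mat n n" and B: "B \<in> carrier_mat n n" and AB: "A * B = 1\<^sub>m n"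
  shows "invertible_mat A" "mat_inv A = B"
proof -
  have BA: "B * A = 1\<^sub>m n" by (rule mat_mult_left_right_inverse[OF A B AB])
  show inv: "invertible_mat A"
    using A B AB BA unfolding invertible_mat_def inverts_mat_def by auto
  note I = mat_inv[OF A inv]
  have "mat_inv A = B * A * mat_inv A" using BA I(1) by simp
  also have "\<dots> = B" using A B I(1,2) by (simp add: assoc_mult_mat[of _ n n _ n _ n])
  finally show "mat_inv A = B" .
qed

theorem theorem3p10:
  fixes A P R S :: "real mat" and n :: nat
  assumes "n > 0"
    and "A \<in> carrier_mat n n"
    and "A\<^sup>T = A"
    and "invertible_mat A"
    and "double_weak_splitting_II n A P R S"
  shows
    "let i    = spectral_radius (map_mat complex_of_real (W_tilde n P R S)) < 1;
         ii   = P * mat_inv A \<ge> 0\<^sub>m n n;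
         ii'  = mat_inv A * P\<^sup>T \<ge> 0\<^sub>m n n;
         iii  = P * mat_inv A \<ge> 1\<^sub>m n;
         iii' = mat_inv A * P\<^sup>T \<ge> 1\<^sub>m n;
         iv   = (R - S) * mat_inv A \<ge> 0\<^sub>m n n;
         iv'  = mat_inv A * (R - S)\<^sup>T \<ge> 0\<^sub>m n n;
         v    = (R - S) * mat_inv A \<ge> - (1\<^sub>m n);
         v'   = mat_inv A * (R - S)\<^sup>T \<ge> - (1\<^sub>m n);
         M    = 1\<^sub>m n - (mat_inv P)\<^sup>T * (R - S)\<^sup>T;
         vi   = invertible_mat M \<and> mat_inv M \<ge> 0\<^sub>m n n;
         vii  = invertible_mat M \<and> mat_inv M \<ge> 1\<^sub>m n
     in (i \<longleftrightarrow> ii) \<and> (i \<longleftrightarrow> iii) \<and> (i \<longleftrightarrow> iv) \<and> (i \<longleftrightarrow> v) \<and> (i \<longleftrightarrow> vi) \<and> (i \<longleftrightarrow> vii) \<and>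
        (ii \<longleftrightarrow> ii') \<and> (iii \<longleftrightarrow> iii') \<and> (iv \<longleftrightarrow> iv') \<and> (v \<longleftrightarrow> v')"
proof -
  note A = assms(2)
  from assms(5) have P: "P \<in> carrier_mat n n" and R: "R \<in> carrier_mat n n"
    and S: "S \<in> carrier_mat n n" and split: "A = P - R + S" and invP: "invertible_mat P"
    and RP: "0\<^sub>m n n \<le> R * mat_inv P" and SP: "0\<^sub>m n n \<le> - (S * mat_inv P)"
    unfolding double_weak_splitting_II_def by auto
  note Q = mat_inv[OF P invP] and B = mat_inv[OF A assms(4)]
  define X where "X = R * mat_inv P"
  \<comment> \<open>The minus sign is absorbed into \<open>Y\<close>, so that \<open>X\<close> and
    \<open>Y\<close> are both nonnegative by the splitting.\<close>
  define Y where "Y = - (S * mat_inv P)"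
  define T where "T = X + Y"
  define N where "N = P * mat_inv A"
  have X: "X \<in> carrier_mat n n" and Y: "Y \<in> carrier_mat n n"
    using R S Q(1) by (auto simp: X_def Y_def)
  have T: "T \<in> carrier_mat n n" using X Y by (simp add: T_def)
  have N: "N \<in> carrier_mat n n" using P B by (simp add: N_def)
  have RS: "R - S \<in> carrier_mat n n" using S by (rule minus_carrier_mat)
  have T_eq: "T = (R - S) * mat_inv P"
    unfolding minus_mult_distrib_mat[OF R S Q(1)] T_def X_def Y_def
    using R S Q(1) by (auto intro!: eq_matI)
  have TP: "T * P = R - S"
    unfolding T_eq using assoc_mult_mat[OF RS Q(1) P] Q(3) right_mult_one_mat[OF RS] by simp
  have TN: "(R - S) * mat_inv A = T * N"
    unfolding N_def TP[symmetric] using T P B(1) by simp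
  have "A = (1\<^sub>m n - T) * P"
    unfolding one_minus_mult_mat[OF T P] TP split
    using P R S by (auto intro!: eq_matI)
  then have inv: "(1\<^sub>m n - T) * N = 1\<^sub>m n"
    using assoc_mult_mat[OF minus_carrier_mat[OF T] P B(1), of "1\<^sub>m n"] B(2) by (simp add: N_def)
  have N_eq: "N - T * N = 1\<^sub>m n"
    using inv one_minus_mult_mat[OF T N] by simp
  \<comment> \<open>Conditions (ii) to (v) are compared entrywise through N = I + T N.\<close>
  have N_entry: "N $$ (i, j) = (1\<^sub>m n) $$ (i, j) + (T * N) $$ (i, j)" if "i < n" "j < n" for i j
    using arg_cong[OF N_eq, of "\<lambda>M. M $$ (i, j)"] that T N by (simp del: index_mult_mat(1))
  have invT: "N * (1\<^sub>m n - T) = 1\<^sub>m n"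
    by (rule mat_mult_left_right_inverse[OF minus_carrier_mat[OF T] N inv])

  have T0: "0\<^sub>m n n \<le> T" using RP SP X Y
    unfolding X_def[symmetric] Y_def[symmetric] T_def by (auto simp: less_eq_mat_def)
  \<comment> \<open>If \<open>N\<close> is nonnegative then so is T N, and N = I + T N dominates the
    identity.\<close>
  have ii_iii: "0\<^sub>m n n \<le> N \<longleftrightarrow> 1\<^sub>m n \<le> N"
  proof
    assume "0\<^sub>m n n \<le> N"
    then have "0\<^sub>m n n \<le> T * N" using T N T0 by (intro mult_mat_nonneg)
    then show "1\<^sub>m n \<le> N"
      using N T by (auto simp: mat_le_iff[of _ n n] N_entry simp del: index_mult_mat(1))
  next
    have "0\<^sub>m n n \<le> (1\<^sub>m n :: real mat)" by (simp add: less_eq_mat_def)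
    also assume "1\<^sub>m n \<le> N"
    finally show "0\<^sub>m n n \<le> N" .
  qed
  have iii_iv: "1\<^sub>m n \<le> N \<longleftrightarrow> 0\<^sub>m n n \<le> T * N"
    using N T by (auto simp: mat_le_iff[of _ n n] N_entry simp del: index_mult_mat(1))
  have ii_v: "0\<^sub>m n n \<le> N \<longleftrightarrow> - (1\<^sub>m n) \<le> T * N"
  proof -
    have "0 \<le> N $$ (i, j) \<longleftrightarrow> (- (1\<^sub>m n)) $$ (i, j) \<le> (T * N) $$ (i, j)" if "i < n" "j < n" for i j
      unfolding N_entry[OF that] using that by auto
    then show ?thesis
      using N T by (simp add: mat_le_iff[of _ n n] del: index_mult_mat(1))
  qed
  \<comment> \<open>The matrix of (vi) and (vii) is the transpose of I - T. Transposing N (I - T) =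
    I shows that it is invertible with inverse N^T, whose sign conditions are those of
    \<open>N\<close>.\<close>
  have M_eq: "1\<^sub>m n - (mat_inv P)\<^sup>T * (R - S)\<^sup>T = (1\<^sub>m n - T)\<^sup>T"
    unfolding T_eq transpose_mult[OF RS Q(1), symmetric]
    using T unfolding T_eq by (subst transpose_minus[of _ n n]) auto
  have invM: "(1\<^sub>m n - T)\<^sup>T * N\<^sup>T = 1\<^sub>m n"
    using transpose_mult[OF N minus_carrier_mat[OF T], of "1\<^sub>m n"] invT by simp
  have M: "(1\<^sub>m n - T)\<^sup>T \<in> carrier_mat n n" using minus_carrier_mat[OF T] by simp
  note M_inv = mat_inv_eqI[OF M _ invM]
  have W_eq: "W_tilde n P R S = four_block_mat (X\<^sup>T) (Y\<^sup>T) (1\<^sub>m n) (0\<^sub>m n n)"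
    unfolding W_tilde_def X_def Y_def transpose_uminus ..
  have nonneg_transpose: "0\<^sub>m n n \<le> Z\<^sup>T \<longleftrightarrow> 0\<^sub>m n n \<le> Z" for Z :: "real mat"
    using transpose_mat_le_iff[of "0\<^sub>m n n" Z] by simp
  have one_transpose: "1\<^sub>m n \<le> Z\<^sup>T \<longleftrightarrow> 1\<^sub>m n \<le> Z" for Z :: "real mat"
    using transpose_mat_le_iff[of "1\<^sub>m n" Z] by simp
  have minus_one_transpose: "- (1\<^sub>m n) \<le> Z\<^sup>T \<longleftrightarrow> - (1\<^sub>m n) \<le> Z" for Z :: "real mat"
    using transpose_mat_le_iff[of "- (1\<^sub>m n)" Z] by (simp add: transpose_uminus)
  have i_ii: "spectral_radius (map_mat complex_of_real (W_tilde n P R S)) < 1 \<longleftrightarrow> 0\<^sub>m n n \<le> N"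
  proof -
    \<comment> \<open>\<open>W_tilde\<close> has transposed upper blocks, so the block criterion is
      used with X^T, Y^T and N^T.\<close>
    have "X\<^sup>T + Y\<^sup>T = T\<^sup>T" unfolding T_def by (rule transpose_add[OF X Y, symmetric])
    then have "(1\<^sub>m n - (X\<^sup>T + Y\<^sup>T)) * N\<^sup>T = 1\<^sub>m n"
      using invM transpose_minus[OF one_carrier_mat T] by simp
    then show ?thesis
      using spectral_radius_block_companion_less_1_iff[of "X\<^sup>T" n "Y\<^sup>T" "N\<^sup>T"] X Y N assms(1) RP SP
      by (simp add: W_eq nonneg_transpose X_def[symmetric] Y_def[symmetric])
  qed
  \<comment> \<open>Symmetry of \<open>A\<close> enters here: its inverse is symmetric too, so each
    primed condition is the transpose of the unprimed one.\<close>
  have "A\<^sup>T * (mat_inv A)\<^sup>T = 1\<^sub>m n"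
    using transpose_mult[OF B(1) A] B(3) by simp
  then have symB: "(mat_inv A)\<^sup>T = mat_inv A"
    using mat_inv_eqI(2)[of A n "(mat_inv A)\<^sup>T"] A B(1) assms(3) by simp
  have P': "mat_inv A * P\<^sup>T = N\<^sup>T"
    unfolding N_def transpose_mult[OF P B(1)] symB ..
  have RS': "mat_inv A * (R - S)\<^sup>T = (T * N)\<^sup>T"
    unfolding TN[symmetric] transpose_mult[OF RS B(1)] symB ..
  show ?thesis
    unfolding Let_def M_eq P' RS' TN N_def[symmetric] nonneg_transpose one_transpose
      minus_one_transpose
    using i_ii ii_iii iii_iv ii_v M_inv N
    by (simp add: nonneg_transpose one_transpose)
qed

end
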